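(* Let $G$ be a graph without loops. Then $G$ is R-reduced if and only if $G$ is a graph core.
   Context: Graphs are finite and undirected: $G=(V_G,E_G)$ with $E_G\subseteq V_G\times V_G$ symmetric. A relation $R\subseteq X\times Y$ has full domain if every $x\in X$ is related to some $p\in Y$, and full image if every $p\in Y$ is related to by some $x\in X$. For a graph $G$, a finite set $B$ and a relation $R\subseteq V_G\times B$ with full image, $G\ast R$ is the graph with vertex set $B$ and edge set $\{(u,v)\in B\times B : \text{there is } (x,y)\in E_G \text{ with } (x,u),(y,v)\in R\}$. The equation $G\ast R=H$ means that $R\subseteq V_G\times V_H$ has full image and $G\ast R$ equals $H$ as a graph. Let $H$ be a subgraph of $G$. An R-retraction of $G$ to $H$ is a relation $R\subseteq V_G\times V_H$ with full domain such that $G\ast R=H$ and $(x,x)\in R$ for all $x\in V_H$. A graph is R-reduced if there is no R-retraction of it to a proper subgraph. A retraction of $G$ to a subgraph $H$ is a graph homomorphism $r:V_G\to V_H$ from $G$ to $H$ with $r(x)=x$ for all $x\in V_H$. A (graph) core is a graph that does not retract to a proper subgraph. *)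

theory Defs
  imports "Graph_Theory.Pair_Digraph" "Graph_Theory.Digraph_Component"
begin

text \<open>
  Finite undirected graphs, loops allowed, are the structures satisfying
  \<^locale>\<open>pair_pseudo_graph\<close> (the edge set is a symmetric relation on the finite vertex set);
  those without loops satisfy \<^locale>\<open>pair_graph\<close>.
\<close>

definition full_domain :: "'a set \<Rightarrow> 'b set \<Rightarrow> ('a \<times> 'b) set \<Rightarrow> bool" where
  "full_domain X Y R \<longleftrightarrow> (\<forall>x\<in>X. \<exists>p\<in>Y. (x, p) \<in> R)"

definition full_image :: "'a set \<Rightarrow> 'b set \<Rightarrow> ('a \<times> 'b) set \<Rightarrow> bool" where
  "full_image X Y R \<longleftrightarrow> (\<forall>p\<in>Y. \<exists>x\<in>X. (x, p) \<in> R)"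

text \<open>The graph \<open>G \<ast> R\<close> for a relation \<open>R \<subseteq> V\<^sub>G \<times> B\<close>; the set \<open>B\<close> is an explicit argument,
  since it cannot be read off from \<open>R\<close> as a set of pairs.\<close>

definition graph_rel_prod :: "'a pair_pre_digraph \<Rightarrow> ('a \<times> 'b) set \<Rightarrow> 'b set \<Rightarrow> 'b pair_pre_digraph" where
  "graph_rel_prod G R B =
    \<lparr> pverts = B,
      parcs = {(u, v) \<in> B \<times> B. \<exists>x y. (x, y) \<in> parcs G \<and> (x, u) \<in> R \<and> (y, v) \<in> R} \<rparr>"

definition graph_rel_prod_eq ::
    "'a pair_pre_digraph \<Rightarrow> ('a \<times> 'b) set \<Rightarrow> 'b pair_pre_digraph \<Rightarrow> bool" where
  "graph_rel_prod_eq G R H \<longleftrightarrow>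
     R \<subseteq> pverts G \<times> pverts H \<and> full_image (pverts G) (pverts H) R \<and>
     graph_rel_prod G R (pverts H) = H"

text \<open>The library's \<^const>\<open>subgraph\<close> is about digraphs and does not force symmetry of the
  edge set of the subgraph.\<close>

definition undirected_subgraph :: "'a pair_pre_digraph \<Rightarrow> 'a pair_pre_digraph \<Rightarrow> bool" where
  "undirected_subgraph H G \<longleftrightarrow> pair_pseudo_graph H \<and> subgraph (with_proj H) (with_proj G)"

definition proper_subgraph :: "'a pair_pre_digraph \<Rightarrow> 'a pair_pre_digraph \<Rightarrow> bool" where
  "proper_subgraph H G \<longleftrightarrow> undirected_subgraph H G \<and> H \<noteq> G"

definition R_retraction ::
    "'a pair_pre_digraph \<Rightarrow> 'a pair_pre_digraph \<Rightarrow> ('a \<times> 'a) set \<Rightarrow> bool" where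
  "R_retraction G H R \<longleftrightarrow>
     undirected_subgraph H G \<and>
     R \<subseteq> pverts G \<times> pverts H \<and> full_domain (pverts G) (pverts H) R \<and>
     graph_rel_prod_eq G R H \<and> (\<forall>x\<in>pverts H. (x, x) \<in> R)"

definition R_reduced :: "'a pair_pre_digraph \<Rightarrow> bool" where
  "R_reduced G \<longleftrightarrow> \<not> (\<exists>H R. proper_subgraph H G \<and> R_retraction G H R)"

text \<open>The values of a homomorphism outside the vertex set of its source are irrelevant.\<close>

definition graph_hom ::
    "'a pair_pre_digraph \<Rightarrow> 'b pair_pre_digraph \<Rightarrow> ('a \<Rightarrow> 'b) \<Rightarrow> bool" where
  "graph_hom G H f \<longleftrightarrow>
     (\<forall>x\<in>pverts G. f x \<in> pverts H) \<and> (\<forall>(x, y)\<in>parcs G. (f x, f y) \<in> parcs H)"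

definition retraction ::
    "'a pair_pre_digraph \<Rightarrow> 'a pair_pre_digraph \<Rightarrow> ('a \<Rightarrow> 'a) \<Rightarrow> bool" where
  "retraction G H r \<longleftrightarrow>
     undirected_subgraph H G \<and> graph_hom G H r \<and> (\<forall>x\<in>pverts H. r x = x)"

definition graph_core :: "'a pair_pre_digraph \<Rightarrow> bool" where
  "graph_core G \<longleftrightarrow> \<not> (\<exists>H r. proper_subgraph H G \<and> retraction G H r)"

end

theory Submission
  imports Defs
begin

text \<open>
  The graph of a retraction is an R-retraction. Conversely, an R-retraction has full domain, so it
  contains the graph of a function that is the identity on the subgraph; every edge is mapped by
  that function into the edge set of \<open>G \<ast> R = H\<close>.
\<close>

lemma undirected_subgraph_pverts:
  "undirected_subgraph H G \<Longrightarrow> pverts H \<subseteq> pverts G"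
  by (auto simp: undirected_subgraph_def subgraph_def)

lemma undirected_subgraph_parcs:
  "undirected_subgraph H G \<Longrightarrow> parcs H \<subseteq> parcs G"
  by (auto simp: undirected_subgraph_def subgraph_def)

lemma undirected_subgraph_parcs_in_pverts:
  assumes "undirected_subgraph H G" and "(u, v) \<in> parcs H"
  shows "u \<in> pverts H" "v \<in> pverts H"
proof -
  interpret pair_pseudo_graph H
    using assms(1) by (simp add: undirected_subgraph_def)
  show "u \<in> pverts H" "v \<in> pverts H"
    using assms(2) in_arcsD1 in_arcsD2 by blast+
qed

text \<open>For this relation the edges of the product are exactly the pairs
  \<open>(r x, r y)\<close> with \<open>(x, y)\<close> an edge of \<open>G\<close>. They lie in
  \<open>H\<close> because \<open>r\<close> is a homomorphism, and they exhaust \<open>H\<close>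
  because \<open>r\<close> fixes both ends of every edge of \<open>H\<close>.\<close>

lemma R_retraction_of_retraction:
  assumes "pair_wf_digraph G" and "retraction G H r"
  shows "R_retraction G H {(x, r x) | x. x \<in> pverts G}"
proof -
  interpret pair_wf_digraph G by fact
  define R where "R = {(x, r x) | x. x \<in> pverts G}"
  have H: "undirected_subgraph H G"
    and hom: "\<And>x. x \<in> pverts G \<Longrightarrow> r x \<in> pverts H"
      "\<And>x y. (x, y) \<in> parcs G \<Longrightarrow> (r x, r y) \<in> parcs H"
    and fixed: "\<And>x. x \<in> pverts H \<Longrightarrow> r x = x"
    using assms(2) by (auto simp: retraction_def graph_hom_def)
  note sub = undirected_subgraph_pverts[OF H] undirected_subgraph_parcs[OF H]
  have diag: "(x, x) \<in> R" if "x \<in> pverts H" for x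
    using that fixed[OF that] sub(1) by (force simp: R_def)
  have edges: "(u, v) \<in> parcs H \<longleftrightarrow> u \<in> pverts H \<and> v \<in> pverts H \<and>
      (\<exists>x y. (x, y) \<in> parcs G \<and> (x, u) \<in> R \<and> (y, v) \<in> R)" for u v
  proof
    assume "(u, v) \<in> parcs H"
    then show "u \<in> pverts H \<and> v \<in> pverts H \<and>
        (\<exists>x y. (x, y) \<in> parcs G \<and> (x, u) \<in> R \<and> (y, v) \<in> R)"
      \<comment> \<open>The witnesses are \<open>x = u\<close> and \<open>y = v\<close>: an edge of
        \<open>H\<close> is an edge of \<open>G\<close> that \<open>R\<close> relates to
        itself.\<close>
      using undirected_subgraph_parcs_in_pverts[OF H] diag sub(2) by blast
  qed (use hom in \<open>auto simp: R_def\<close>)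
  have "graph_rel_prod G R (pverts H) = H"
    using edges unfolding graph_rel_prod_def
    by (intro pair_pre_digraph.equality) (simp_all add: set_eq_iff)
  moreover have "R \<subseteq> pverts G \<times> pverts H" "\<forall>x\<in>pverts G. \<exists>p\<in>pverts H. (x, p) \<in> R"
    using hom(1) by (auto simp: R_def)
  \<comment> \<open>Full image also comes from \<open>diag\<close>, since each vertex of
    \<open>H\<close> is a vertex of \<open>G\<close> related to itself.\<close>
  ultimately show ?thesis
    using H diag sub(1) unfolding R_def[symmetric] R_retraction_def graph_rel_prod_eq_def full_domain_def full_image_def by blast
qed

lemma retraction_of_R_retraction:
  assumes "pair_wf_digraph G" and "R_retraction G H R"
  obtains r where "retraction G H r"
proof -
  interpret pair_wf_digraph G by fact
  have H: "undirected_subgraph H G"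
    and dom: "\<forall>x\<in>pverts G. \<exists>p\<in>pverts H. (x, p) \<in> R"
    and prod: "graph_rel_prod G R (pverts H) = H"
    and diag: "\<And>x. x \<in> pverts H \<Longrightarrow> (x, x) \<in> R"
    using assms(2) by (auto simp: R_retraction_def graph_rel_prod_eq_def full_domain_def)
  obtain f where f: "\<And>x. x \<in> pverts G \<Longrightarrow> f x \<in> pverts H \<and> (x, f x) \<in> R"
    using dom by metis
  \<comment> \<open>The choice \<open>f\<close> may move vertices of \<open>H\<close>, so it is
    overridden by the identity there; \<open>diag\<close> keeps the new pairs in
    \<open>R\<close>.\<close>
  define r where "r x = (if x \<in> pverts H then x else f x)" for x
  have r: "r x \<in> pverts H \<and> (x, r x) \<in> R" if "x \<in> pverts G" for x
    using f[OF that] diag by (simp add: r_def)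
  have "(r x, r y) \<in> parcs H" if "(x, y) \<in> parcs G" for x y
  proof -
    \<comment> \<open>The edge \<open>(x, y)\<close> itself is the witness, as \<open>R\<close>
      relates its ends to \<open>r x\<close> and \<open>r y\<close>.\<close>
    have "(r x, r y) \<in> parcs (graph_rel_prod G R (pverts H))"
      using that r in_arcsD1[OF that] in_arcsD2[OF that] by (auto simp: graph_rel_prod_def)
    then show ?thesis by (simp add: prod)
  qed
  moreover have "\<forall>x\<in>pverts H. r x = x"
    by (simp add: r_def)
  ultimately have "retraction G H r"
    using H r by (auto simp: retraction_def graph_hom_def)
  then show thesis by (rule that)
qed

theorem proposition5p8:
  fixes G :: "'a pair_pre_digraph"
  assumes "pair_graph G"
  shows "R_reduced G \<longleftrightarrow> graph_core G"
proof -
  interpret pair_graph G by fact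
  have "pair_wf_digraph G" by unfold_locales
  \<comment> \<open>Both lemmas keep \<open>H\<close> unchanged, so the same proper subgraph refutes
    both properties.\<close>
  then show ?thesis
    unfolding R_reduced_def graph_core_def
    by (meson R_retraction_of_retraction retraction_of_R_retraction)
qed

end
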